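(* Let $S$ be a $\Gamma$-semigroup, let $\gamma_0 \in \Gamma$ be a fixed element, and let $\Sigma$ be the universal semigroup of $S$ (with respect to $\gamma_0$). For every $x \in S$, the right ideal of $\Sigma$ generated by $x$ is the set $$(x)_{r}^{\Sigma} = (x)_{r}^{\Gamma} \cup (x)_{r}^{\Gamma}\Gamma,$$ where $(x)_{r}^{\Gamma} = x\Gamma S \cup \{x\}$ is the right ideal of the $\Gamma$-semigroup $S$ generated by $x$, and $(x)_{r}^{\Gamma}\Gamma = \{y\gamma : \gamma \in \Gamma,\ y \in (x)_{r}^{\Gamma}\} \subseteq \Sigma$.
   Context: Let $S$ and $\Gamma$ be non-empty sets. A $\Gamma$-semigroup is a set $S$ together with a map $S \times \Gamma \times S \to S$, $(a,\gamma,b) \mapsto a\gamma b$, such that $(a\alpha b)\beta c = a\alpha(b\beta c)$ for all $a,b,c \in S$ and $\alpha,\beta \in \Gamma$. A right ideal of the $\Gamma$-semigroup $S$ is a non-empty subset $R \subseteq S$ with $a\gamma s \in R$ for all $a \in R$, $\gamma \in \Gamma$, $s \in S$. Write $x\Gamma S = \{x\gamma s : s \in S,\ \gamma \in \Gamma\}$. The universal semigroup $\Sigma$ of $S$ (with respect to a fixed $\gamma_0 \in \Gamma$) is the quotient of the free semigroup $F$ on the disjoint union $S \cup \Gamma$ by the congruence generated by the relations $(\gamma_1,\gamma_2) \sim \gamma_1$, $(x,\gamma,y) \sim x\gamma y$, and $(x,y) \sim x\gamma_0 y$, for all $\gamma_1,\gamma_2,\gamma \in \Gamma$ and $x,y \in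 S$; here $(u_1,\dots,u_n)$ denotes a word in $F$ with letters $u_1,\dots,u_n$, and $x\gamma y$, $x\gamma_0 y$ on the right-hand sides are single letters in $S$. The canonical map $F \to \Sigma$ is injective on $S$ and on $\Gamma$, and elements of $S$ and $\Gamma$ are identified with their images in $\Sigma$. For $y \in S$ and $\gamma \in \Gamma$, $y\gamma \in \Sigma$ denotes the product in $\Sigma$ of $y$ and $\gamma$. *)

theory Defs
  imports Main
begin

locale gamma_semigroup =
  fixes S :: "'s set" and \<Gamma> :: "'g set" and m :: "'s \<Rightarrow> 'g \<Rightarrow> 's \<Rightarrow> 's"
  assumes S_nonempty: "S \<noteq> {}"
    and Gamma_nonempty: "\<Gamma> \<noteq> {}"
    and closed: "\<lbrakk>a \<in> S; \<gamma> \<in> \<Gamma>; b \<in> S\<rbrakk> \<Longrightarrow> m a \<gamma> b \<in> S"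
    and assoc: "\<lbrakk>a \<in> S; \<alpha> \<in> \<Gamma>; b \<in> S; \<beta> \<in> \<Gamma>; c \<in> S\<rbrakk>
      \<Longrightarrow> m (m a \<alpha> b) \<beta> c = m a \<alpha> (m b \<beta> c)"

definition gamma_right_ideal ::
    "'s set \<Rightarrow> 'g set \<Rightarrow> ('s \<Rightarrow> 'g \<Rightarrow> 's \<Rightarrow> 's) \<Rightarrow> 's set \<Rightarrow> bool" where
  "gamma_right_ideal S \<Gamma> m R \<longleftrightarrow>
    R \<noteq> {} \<and> R \<subseteq> S \<and> (\<forall>a\<in>R. \<forall>\<gamma>\<in>\<Gamma>. \<forall>s\<in>S. m a \<gamma> s \<in> R)"

definition gamma_right_ideal_gen ::
    "'s set \<Rightarrow> 'g set \<Rightarrow> ('s \<Rightarrow> 'g \<Rightarrow> 's \<Rightarrow> 's) \<Rightarrow> 's \<Rightarrow> 's set" where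
  "gamma_right_ideal_gen S \<Gamma> m x = \<Inter>{R. gamma_right_ideal S \<Gamma> m R \<and> x \<in> R}"

text \<open>Ordinary semigroups are given by a carrier set and a multiplication.\<close>

definition sg_right_ideal :: "'a set \<Rightarrow> ('a \<Rightarrow> 'a \<Rightarrow> 'a) \<Rightarrow> 'a set \<Rightarrow> bool" where
  "sg_right_ideal C f R \<longleftrightarrow> R \<noteq> {} \<and> R \<subseteq> C \<and> (\<forall>a\<in>R. \<forall>s\<in>C. f a s \<in> R)"

definition sg_right_ideal_gen :: "'a set \<Rightarrow> ('a \<Rightarrow> 'a \<Rightarrow> 'a) \<Rightarrow> 'a \<Rightarrow> 'a set" where
  "sg_right_ideal_gen C f x = \<Inter>{R. sg_right_ideal C f R \<and> x \<in> R}"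

text \<open>The free semigroup on an alphabet consists of the non-empty words, multiplied by
  concatenation.\<close>

definition free_sg :: "'a set \<Rightarrow> 'a list set" where
  "free_sg A = lists A - {[]}"

inductive_set cong_gen :: "'a set \<Rightarrow> ('a list \<times> 'a list) set \<Rightarrow> ('a list \<times> 'a list) set"
  for A :: "'a set" and E :: "('a list \<times> 'a list) set" where
  base: "\<lbrakk>(u, v) \<in> E; u \<in> free_sg A; v \<in> free_sg A\<rbrakk> \<Longrightarrow> (u, v) \<in> cong_gen A E"
| refl: "u \<in> free_sg A \<Longrightarrow> (u, u) \<in> cong_gen A E"
| sym: "(u, v) \<in> cong_gen A E \<Longrightarrow> (v, u) \<in> cong_gen A E"
| trans: "\<lbrakk>(u, v) \<in> cong_gen A E; (v, w) \<in> cong_gen A E\<rbrakk> \<Longrightarrow> (u, w) \<in> cong_gen A E"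
| left: "\<lbrakk>(u, v) \<in> cong_gen A E; w \<in> free_sg A\<rbrakk> \<Longrightarrow> (w @ u, w @ v) \<in> cong_gen A E"
| right: "\<lbrakk>(u, v) \<in> cong_gen A E; w \<in> free_sg A\<rbrakk> \<Longrightarrow> (u @ w, v @ w) \<in> cong_gen A E"

text \<open>In the disjoint union \<open>S <+> \<Gamma>\<close> the letters from \<open>S\<close> are tagged \<open>Inl\<close> and those
  from \<open>\<Gamma>\<close> are tagged \<open>Inr\<close>.\<close>

definition univ_rels ::
    "'s set \<Rightarrow> 'g set \<Rightarrow> ('s \<Rightarrow> 'g \<Rightarrow> 's \<Rightarrow> 's) \<Rightarrow> 'g
      \<Rightarrow> (('s + 'g) list \<times> ('s + 'g) list) set" where
  "univ_rels S \<Gamma> m \<gamma>0 =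
    {([Inr \<gamma>1, Inr \<gamma>2], [Inr \<gamma>1]) | \<gamma>1 \<gamma>2. \<gamma>1 \<in> \<Gamma> \<and> \<gamma>2 \<in> \<Gamma>}
    \<union> {([Inl x, Inr \<gamma>, Inl y], [Inl (m x \<gamma> y)]) | x \<gamma> y. x \<in> S \<and> \<gamma> \<in> \<Gamma> \<and> y \<in> S}
    \<union> {([Inl x, Inl y], [Inl (m x \<gamma>0 y)]) | x y. x \<in> S \<and> y \<in> S}"

definition univ_cong ::
    "'s set \<Rightarrow> 'g set \<Rightarrow> ('s \<Rightarrow> 'g \<Rightarrow> 's \<Rightarrow> 's) \<Rightarrow> 'g
      \<Rightarrow> (('s + 'g) list \<times> ('s + 'g) list) set" where
  "univ_cong S \<Gamma> m \<gamma>0 = cong_gen (S <+> \<Gamma>) (univ_rels S \<Gamma> m \<gamma>0)"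

definition univ_sg ::
    "'s set \<Rightarrow> 'g set \<Rightarrow> ('s \<Rightarrow> 'g \<Rightarrow> 's \<Rightarrow> 's) \<Rightarrow> 'g \<Rightarrow> ('s + 'g) list set set" where
  "univ_sg S \<Gamma> m \<gamma>0 = free_sg (S <+> \<Gamma>) // univ_cong S \<Gamma> m \<gamma>0"

definition univ_mult ::
    "'s set \<Rightarrow> 'g set \<Rightarrow> ('s \<Rightarrow> 'g \<Rightarrow> 's \<Rightarrow> 's) \<Rightarrow> 'g
      \<Rightarrow> ('s + 'g) list set \<Rightarrow> ('s + 'g) list set \<Rightarrow> ('s + 'g) list set" where
  "univ_mult S \<Gamma> m \<gamma>0 U V = (\<Union>u\<in>U. \<Union>v\<in>V. univ_cong S \<Gamma> m \<gamma>0 `` {u @ v})"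

definition univ_letter ::
    "'s set \<Rightarrow> 'g set \<Rightarrow> ('s \<Rightarrow> 'g \<Rightarrow> 's \<Rightarrow> 's) \<Rightarrow> 'g \<Rightarrow> 's + 'g \<Rightarrow> ('s + 'g) list set" where
  "univ_letter S \<Gamma> m \<gamma>0 a = univ_cong S \<Gamma> m \<gamma>0 `` {[a]}"

lemma cong_gen_free_sg:
  "(u, v) \<in> cong_gen A E \<Longrightarrow> u \<in> free_sg A \<and> v \<in> free_sg A"
  by (induction rule: cong_gen.induct) (auto simp: free_sg_def)

lemma equiv_cong_gen: "equiv (free_sg A) (cong_gen A E)"
  by (rule equivI)
    (auto simp: refl_on_def sym_def intro!: transI
      intro: cong_gen.refl cong_gen.sym cong_gen.trans dest: cong_gen_free_sg)

text \<open>The multiplication of classes does not depend on representatives.\<close>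

lemma univ_mult_class:
  assumes "u \<in> free_sg (S <+> \<Gamma>)" and "v \<in> free_sg (S <+> \<Gamma>)"
  shows "univ_mult S \<Gamma> m \<gamma>0 (univ_cong S \<Gamma> m \<gamma>0 `` {u}) (univ_cong S \<Gamma> m \<gamma>0 `` {v})
    = univ_cong S \<Gamma> m \<gamma>0 `` {u @ v}"
proof -
  let ?A = "S <+> \<Gamma>" and ?r = "univ_cong S \<Gamma> m \<gamma>0"
  have eq: "equiv (free_sg ?A) ?r"
    unfolding univ_cong_def by (rule equiv_cong_gen)
  have "?r `` {u' @ v'} = ?r `` {u @ v}" if "(u, u') \<in> ?r" "(v, v') \<in> ?r" for u' v'
  proof -
    have "u' \<in> free_sg ?A"
      using that(1) cong_gen_free_sg unfolding univ_cong_def by blast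
    then have "(u @ v, u' @ v') \<in> ?r"
      using that assms unfolding univ_cong_def
      by (meson cong_gen.left cong_gen.right cong_gen.trans)
    then show ?thesis
      using equiv_class_eq[OF eq] by blast
  qed
  moreover have "(u, u) \<in> ?r" "(v, v) \<in> ?r"
    using assms unfolding univ_cong_def by (auto intro: cong_gen.refl)
  ultimately show ?thesis
    unfolding univ_mult_def by blast
qed

end

theory Submission
  imports Defs
begin

text \<open>In \<open>\<Sigma>\<close> every word \<open>y a\<close> or \<open>y \<gamma> a\<close> with \<open>y \<in> S\<close> and a letter \<open>a\<close> reduces to a word of the
  form \<open>z\<close> or \<open>z \<delta>\<close>, where \<open>z\<close> lies in the right ideal of the \<open>\<Gamma>\<close>-semigroup generated by \<open>y\<close>.
  Hence the right-hand side absorbs right multiplication by letters, so by words. Conversely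
  \<open>x\<gamma>s\<close> is in \<open>\<Sigma>\<close> the product of \<open>x\<close> with the word \<open>\<gamma> s\<close>.\<close>

context gamma_semigroup
begin

text \<open>Associativity rewrites a product of \<open>m x \<gamma> s\<close> with
  \<open>\<delta>\<close> and \<open>t\<close> as \<open>m x \<gamma> (m s \<delta> t)\<close>,
  which again begins with \<open>x\<close>.\<close>

lemma gamma_right_ideal_principal:
  assumes "x \<in> S"
  shows "gamma_right_ideal S \<Gamma> m ({m x \<gamma> s | \<gamma> s. \<gamma> \<in> \<Gamma> \<and> s \<in> S} \<union> {x})"
proof -
  have "m (m x \<gamma> s) \<delta> t \<in> {m x \<gamma> s | \<gamma> s. \<gamma> \<in> \<Gamma> \<and> s \<in> S}"
    if "\<gamma> \<in> \<Gamma>" "s \<in> S" "\<delta> \<in> \<Gamma>" "t \<in> S" for \<gamma> s \<delta> t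
    using assoc[OF assms that] closed[OF that(2-4)] that(1) by blast
  moreover have "m x \<gamma> s \<in> S" if "\<gamma> \<in> \<Gamma>" "s \<in> S" for \<gamma> s
    using closed[OF assms that] .
  ultimately show ?thesis
    unfolding gamma_right_ideal_def using assms by blast
qed

text \<open>The right-hand side is one of the ideals being intersected, and closure of any ideal
  containing \<open>x\<close> forces all \<open>m x \<gamma> s\<close> into it.\<close>

lemma gamma_right_ideal_gen_eq:
  assumes "x \<in> S"
  shows "gamma_right_ideal_gen S \<Gamma> m x = {m x \<gamma> s | \<gamma> s. \<gamma> \<in> \<Gamma> \<and> s \<in> S} \<union> {x}"
proof
  show "gamma_right_ideal_gen S \<Gamma> m x \<subseteq> {m x \<gamma> s | \<gamma> s. \<gamma> \<in> \<Gamma> \<and> s \<in> S} \<union> {x}"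
    unfolding gamma_right_ideal_gen_def using gamma_right_ideal_principal[OF assms]
    by (intro Inter_lower) blast
  show "{m x \<gamma> s | \<gamma> s. \<gamma> \<in> \<Gamma> \<and> s \<in> S} \<union> {x} \<subseteq> gamma_right_ideal_gen S \<Gamma> m x"
    unfolding gamma_right_ideal_gen_def gamma_right_ideal_def by blast
qed

end

locale pointed_gamma_semigroup = gamma_semigroup S \<Gamma> m
  for S :: "'s set" and \<Gamma> :: "'g set" and m :: "'s \<Rightarrow> 'g \<Rightarrow> 's \<Rightarrow> 's" +
  fixes \<gamma>0 :: 'g
  assumes base_point: "\<gamma>0 \<in> \<Gamma>"
begin

abbreviation words :: "('s + 'g) list set" where
  "words \<equiv> free_sg (S <+> \<Gamma>)"

abbreviation cls :: "('s + 'g) list \<Rightarrow> ('s + 'g) list set" where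
  "cls u \<equiv> univ_cong S \<Gamma> m \<gamma>0 `` {u}"

lemma cls_in_univ_sg: "u \<in> words \<Longrightarrow> cls u \<in> univ_sg S \<Gamma> m \<gamma>0"
  unfolding univ_sg_def by (rule quotientI)

lemma univ_sgE:
  assumes "U \<in> univ_sg S \<Gamma> m \<gamma>0"
  obtains u where "u \<in> words" and "U = cls u"
  using assms unfolding univ_sg_def by (rule quotientE)

text \<open>The class of a concatenation is the product of the classes, so it depends on the prefix
  only through its class. This lets a prefix be reduced inside a longer word.\<close>

lemma cls_append_cong:
  assumes "cls u = cls v" "u \<in> words" "v \<in> words" "w \<in> words"
  shows "cls (u @ w) = cls (v @ w)"
  using univ_mult_class[OF assms(2,4), of m \<gamma>0] univ_mult_class[OF assms(3,4), of m \<gamma>0]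
  by (simp add: assms(1))

lemma cls_Inr_Inr:
  assumes "\<gamma> \<in> \<Gamma>" "\<delta> \<in> \<Gamma>"
  shows "cls [Inr \<gamma>, Inr \<delta>] = cls [Inr \<gamma>]"
  using assms unfolding univ_cong_def
  by (intro equiv_class_eq[OF equiv_cong_gen] cong_gen.base)
    (auto simp: univ_rels_def free_sg_def)

text \<open>Multiply the relation \<open>cls_Inr_Inr\<close> on the left by the class of
  \<open>[Inl y]\<close>.\<close>

lemma cls_Inl_Inr_Inr:
  assumes "y \<in> S" "\<gamma> \<in> \<Gamma>" "\<delta> \<in> \<Gamma>"
  shows "cls [Inl y, Inr \<gamma>, Inr \<delta>] = cls [Inl y, Inr \<gamma>]"
proof -
  have "[Inl y] \<in> words" "[Inr \<gamma>, Inr \<delta>] \<in> words" "[Inr \<gamma>] \<in> words"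
    using assms by (auto simp: free_sg_def)
  then show ?thesis
    using univ_mult_class[of "[Inl y]" S \<Gamma> "[Inr \<gamma>, Inr \<delta>]" m \<gamma>0]
      univ_mult_class[of "[Inl y]" S \<Gamma> "[Inr \<gamma>]" m \<gamma>0]
    by (simp add: cls_Inr_Inr[OF assms(2,3)])
qed

lemma cls_Inl_Inr_Inl:
  assumes "y \<in> S" "\<gamma> \<in> \<Gamma>" "s \<in> S"
  shows "cls [Inl y, Inr \<gamma>, Inl s] = cls [Inl (m y \<gamma> s)]"
  using assms closed unfolding univ_cong_def
  by (intro equiv_class_eq[OF equiv_cong_gen] cong_gen.base)
    (auto simp: univ_rels_def free_sg_def)

lemma cls_Inl_Inl:
  assumes "y \<in> S" "s \<in> S"
  shows "cls [Inl y, Inl s] = cls [Inl (m y \<gamma>0 s)]"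
  using assms closed base_point unfolding univ_cong_def
  by (intro equiv_class_eq[OF equiv_cong_gen] cong_gen.base)
    (auto simp: univ_rels_def free_sg_def)

text \<open>The candidate ideal, \<open>I\<close> together with \<open>I\<close> times
  \<open>\<Gamma>\<close> inside the universal semigroup. Products are written as two-letter words
  so that the reduction rules apply to them directly.\<close>

definition extension :: "'s set \<Rightarrow> ('s + 'g) list set set" where
  "extension I = {cls [Inl y] | y. y \<in> I} \<union> {cls [Inl y, Inr \<gamma>] | \<gamma> y. \<gamma> \<in> \<Gamma> \<and> y \<in> I}"

lemma extension_cases:
  assumes "U \<in> extension I"
  obtains y where "y \<in> I" "U = cls [Inl y]"
  | y \<gamma> where "y \<in> I" "\<gamma> \<in> \<Gamma>" "U = cls [Inl y, Inr \<gamma>]"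
  using assms unfolding extension_def by blast

text \<open>Two normal forms times two kinds of letter: \<open>y s\<close> reduces to
  \<open>m y \<gamma>0 s\<close>, \<open>y \<delta>\<close> is already normal,
  \<open>y \<gamma> s\<close> reduces to \<open>m y \<gamma> s\<close>, and
  \<open>y \<gamma> \<delta>\<close> reduces to \<open>y \<gamma>\<close>. The ideal property of
  \<open>I\<close> keeps the new \<open>S\<close>-letters in \<open>I\<close>.\<close>

lemma extension_letter:
  assumes I: "gamma_right_ideal S \<Gamma> m I" and u: "cls u \<in> extension I" "u \<in> words"
    and a: "a \<in> S <+> \<Gamma>"
  shows "cls (u @ [a]) \<in> extension I"
proof -
  have sub: "y \<in> S" if "y \<in> I" for y
    using I that unfolding gamma_right_ideal_def by blast
  have mult: "m y \<gamma> s \<in> I" if "y \<in> I" "\<gamma> \<in> \<Gamma>" "s \<in> S" for y \<gamma> s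
    using I that unfolding gamma_right_ideal_def by blast
  have aw: "[a] \<in> words"
    using a by (auto simp: free_sg_def)
  from a consider s where "s \<in> S" "a = Inl s" | \<delta> where "\<delta> \<in> \<Gamma>" "a = Inr \<delta>"
    by blast
  note letter = this
  show ?thesis
    using u(1)
  proof (cases rule: extension_cases)
    case (1 y)
    \<comment> \<open>The representative \<open>u\<close> is arbitrary, so it is traded for its
      normal form before the letter is absorbed.\<close>
    then have "cls (u @ [a]) = cls [Inl y, a]"
      using cls_append_cong[OF 1(2) u(2) _ aw] sub by (auto simp: free_sg_def)
    moreover have "cls [Inl y, a] \<in> extension I"
      using letter
    proof cases
      case (1 s)
      then show ?thesis
        using cls_Inl_Inl[OF sub] mult base_point \<open>y \<in> I\<close> unfolding extension_def by blast
    next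
      case (2 \<delta>)
      then show ?thesis
        using \<open>y \<in> I\<close> unfolding extension_def by blast
    qed
    ultimately show ?thesis by simp
  next
    case (2 y \<gamma>)
    then have "cls (u @ [a]) = cls [Inl y, Inr \<gamma>, a]"
      using cls_append_cong[OF 2(3) u(2) _ aw] sub by (auto simp: free_sg_def)
    moreover have "cls [Inl y, Inr \<gamma>, a] \<in> extension I"
      using letter
    proof cases
      case (1 s)
      then show ?thesis
        using cls_Inl_Inr_Inl[OF sub] mult 2(1,2) unfolding extension_def by blast
    next
      case (2 \<delta>)
      then show ?thesis
        using cls_Inl_Inr_Inr[OF sub] \<open>y \<in> I\<close> \<open>\<gamma> \<in> \<Gamma>\<close> unfolding extension_def by blast
    qed
    ultimately show ?thesis by simp
  qed
qed

lemma extension_word: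
  assumes I: "gamma_right_ideal S \<Gamma> m I" and u: "cls u \<in> extension I" "u \<in> words"
    and w: "w \<in> lists (S <+> \<Gamma>)"
  shows "cls (u @ w) \<in> extension I"
  using w
proof (induction w rule: rev_induct)
  case Nil
  then show ?case using u by simp
next
  case (snoc a w)
  then have "u @ w \<in> words" "cls (u @ w) \<in> extension I" "a \<in> S <+> \<Gamma>"
    using u(2) by (auto simp: free_sg_def)
  then show ?case
    using extension_letter[OF I, of "u @ w" a] by simp
qed

lemma sg_right_ideal_extension:
  assumes I: "gamma_right_ideal S \<Gamma> m I"
  shows "sg_right_ideal (univ_sg S \<Gamma> m \<gamma>0) (univ_mult S \<Gamma> m \<gamma>0) (extension I)"
  unfolding sg_right_ideal_def
proof (intro conjI ballI)
  show "extension I \<noteq> {}"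
    using I unfolding extension_def gamma_right_ideal_def by blast
  \<comment> \<open>The normal forms are words over the alphabet because \<open>I\<close> lies in
    \<open>S\<close>; this serves both the inclusion and the closure under multiplication.\<close>
  have rep: "\<exists>u\<in>words. U = cls u" if "U \<in> extension I" for U
    using that
  proof (cases rule: extension_cases)
    case (1 y)
    moreover have "[Inl y] \<in> words"
      using 1 I by (auto simp: free_sg_def gamma_right_ideal_def)
    ultimately show ?thesis by blast
  next
    case (2 y \<gamma>)
    moreover have "[Inl y, Inr \<gamma>] \<in> words"
      using 2 I by (auto simp: free_sg_def gamma_right_ideal_def)
    ultimately show ?thesis by blast
  qed
  then show "extension I \<subseteq> univ_sg S \<Gamma> m \<gamma>0"
    using cls_in_univ_sg by blast
  fix U V
  assume U: "U \<in> extension I" and "V \<in> univ_sg S \<Gamma> m \<gamma>0"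
  then obtain u v where "u \<in> words" "U = cls u" "v \<in> words" "V = cls v"
    using rep by (meson univ_sgE)
  then show "univ_mult S \<Gamma> m \<gamma>0 U V \<in> extension I"
    using extension_word[OF I, of u v] U univ_mult_class[of u S \<Gamma> v m \<gamma>0]
    by (simp add: free_sg_def)
qed

text \<open>Minimality: starting from \<open>x\<close>, right multiplication by words reaches first
  every letter of the generated ideal, then every such letter followed by some
  \<open>\<gamma>\<close>.\<close>

lemma extension_subset_sg_right_ideal:
  assumes x: "x \<in> S"
    and R: "sg_right_ideal (univ_sg S \<Gamma> m \<gamma>0) (univ_mult S \<Gamma> m \<gamma>0) R" "cls [Inl x] \<in> R"
  shows "extension (gamma_right_ideal_gen S \<Gamma> m x) \<subseteq> R"
proof -
  have mult: "cls (u @ v) \<in> R" if "cls u \<in> R" "u \<in> words" "v \<in> words" for u v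
    using R(1) that(1) cls_in_univ_sg[OF that(3)] univ_mult_class[OF that(2,3), of m \<gamma>0]
    unfolding sg_right_ideal_def by fastforce
  have letter: "y \<in> S \<and> cls [Inl y] \<in> R" if y: "y \<in> gamma_right_ideal_gen S \<Gamma> m x" for y
  proof (cases "y = x")
    case True
    then show ?thesis using x R(2) by simp
  next
    case False
    then obtain \<gamma> s where "\<gamma> \<in> \<Gamma>" "s \<in> S" "y = m x \<gamma> s"
      using y gamma_right_ideal_gen_eq[OF x] by blast
    then show ?thesis
      \<comment> \<open>The multiplier is the word \<open>\<gamma> s\<close>; a defining relation
        collapses \<open>x \<gamma> s\<close> to the single letter \<open>y\<close>.\<close>
      using mult[OF R(2), of "[Inr \<gamma>, Inl s]"] cls_Inl_Inr_Inl[OF x] closed[OF x] x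
      by (auto simp: free_sg_def)
  qed
  have "cls [Inl y, Inr \<gamma>] \<in> R" if "y \<in> gamma_right_ideal_gen S \<Gamma> m x" "\<gamma> \<in> \<Gamma>" for y \<gamma>
    using mult[of "[Inl y]" "[Inr \<gamma>]"] letter[OF that(1)] that(2)
    by (auto simp: free_sg_def)
  with letter show ?thesis
    unfolding extension_def by blast
qed

lemma sg_right_ideal_gen_letter:
  assumes x: "x \<in> S"
  shows "sg_right_ideal_gen (univ_sg S \<Gamma> m \<gamma>0) (univ_mult S \<Gamma> m \<gamma>0) (cls [Inl x])
    = extension (gamma_right_ideal_gen S \<Gamma> m x)"
proof
  have "cls [Inl x] \<in> extension (gamma_right_ideal_gen S \<Gamma> m x)"
    unfolding extension_def gamma_right_ideal_gen_eq[OF x] by blast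
  moreover have "gamma_right_ideal S \<Gamma> m (gamma_right_ideal_gen S \<Gamma> m x)"
    using gamma_right_ideal_principal[OF x] gamma_right_ideal_gen_eq[OF x] by simp
  ultimately show "sg_right_ideal_gen (univ_sg S \<Gamma> m \<gamma>0) (univ_mult S \<Gamma> m \<gamma>0) (cls [Inl x])
    \<subseteq> extension (gamma_right_ideal_gen S \<Gamma> m x)"
    unfolding sg_right_ideal_gen_def by (intro Inter_lower CollectI conjI sg_right_ideal_extension)
  show "extension (gamma_right_ideal_gen S \<Gamma> m x)
    \<subseteq> sg_right_ideal_gen (univ_sg S \<Gamma> m \<gamma>0) (univ_mult S \<Gamma> m \<gamma>0) (cls [Inl x])"
    unfolding sg_right_ideal_gen_def
    by (intro Inter_greatest extension_subset_sg_right_ideal[OF x]) auto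
qed

text \<open>Translates the products of letter classes in the theorem into the two-letter words used
  by \<open>extension\<close>.\<close>

lemma univ_mult_letters:
  assumes "a \<in> S <+> \<Gamma>" "b \<in> S <+> \<Gamma>"
  shows "univ_mult S \<Gamma> m \<gamma>0 (univ_letter S \<Gamma> m \<gamma>0 a) (univ_letter S \<Gamma> m \<gamma>0 b) = cls [a, b]"
  using univ_mult_class[of "[a]" S \<Gamma> "[b]"] assms by (auto simp: univ_letter_def free_sg_def)

end

theorem proposition1p2:
  fixes S :: "'s set" and \<Gamma> :: "'g set" and m :: "'s \<Rightarrow> 'g \<Rightarrow> 's \<Rightarrow> 's"
    and \<gamma>0 :: 'g and x :: 's
  assumes "gamma_semigroup S \<Gamma> m"
    and "\<gamma>0 \<in> \<Gamma>"
    and "x \<in> S"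
  shows "gamma_right_ideal_gen S \<Gamma> m x = {m x \<gamma> s | \<gamma> s. \<gamma> \<in> \<Gamma> \<and> s \<in> S} \<union> {x}
    \<and> sg_right_ideal_gen (univ_sg S \<Gamma> m \<gamma>0) (univ_mult S \<Gamma> m \<gamma>0)
        (univ_letter S \<Gamma> m \<gamma>0 (Inl x))
      = {univ_letter S \<Gamma> m \<gamma>0 (Inl y) | y. y \<in> gamma_right_ideal_gen S \<Gamma> m x}
        \<union> {univ_mult S \<Gamma> m \<gamma>0 (univ_letter S \<Gamma> m \<gamma>0 (Inl y)) (univ_letter S \<Gamma> m \<gamma>0 (Inr \<gamma>))
            | \<gamma> y. \<gamma> \<in> \<Gamma> \<and> y \<in> gamma_right_ideal_gen S \<Gamma> m x}"
proof -
  interpret pointed_gamma_semigroup S \<Gamma> m \<gamma>0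
    using assms by (simp add: pointed_gamma_semigroup_def pointed_gamma_semigroup_axioms_def)
  \<comment> \<open>Ensures that \<open>Inl y\<close> is a letter of the alphabet, so that its
    products are classes of words.\<close>
  have "y \<in> S" if "y \<in> gamma_right_ideal_gen S \<Gamma> m x" for y
    using that gamma_right_ideal_gen_eq closed \<open>x \<in> S\<close> by auto
  then have "univ_mult S \<Gamma> m \<gamma>0 (univ_letter S \<Gamma> m \<gamma>0 (Inl y)) (univ_letter S \<Gamma> m \<gamma>0 (Inr \<gamma>))
      = cls [Inl y, Inr \<gamma>]" if "y \<in> gamma_right_ideal_gen S \<Gamma> m x" "\<gamma> \<in> \<Gamma>" for y \<gamma>
    using that by (intro univ_mult_letters) auto
  then have "extension (gamma_right_ideal_gen S \<Gamma> m x)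
      = {univ_letter S \<Gamma> m \<gamma>0 (Inl y) | y. y \<in> gamma_right_ideal_gen S \<Gamma> m x}
        \<union> {univ_mult S \<Gamma> m \<gamma>0 (univ_letter S \<Gamma> m \<gamma>0 (Inl y)) (univ_letter S \<Gamma> m \<gamma>0 (Inr \<gamma>))
            | \<gamma> y. \<gamma> \<in> \<Gamma> \<and> y \<in> gamma_right_ideal_gen S \<Gamma> m x}"
    unfolding extension_def univ_letter_def by (metis (no_types, lifting))
  then show ?thesis
    using gamma_right_ideal_gen_eq[OF \<open>x \<in> S\<close>] sg_right_ideal_gen_letter[OF \<open>x \<in> S\<close>]
    by (simp add: univ_letter_def)
qed

end
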